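(* For any $\mu$ there exists $\epsilon>0$ such that every periodic solution $\alpha(t)=(y_1(t),y_2(t))$ of $$\ddot y_1=\frac{\partial\omega}{\partial y_1}+2\dot y_2,\qquad \ddot y_2=\frac{\partial\omega}{\partial y_2}-2\dot y_1$$ with Jacobian integral different from $C_0=3-\mu+\mu^2$ that is contained in the disk $D_\epsilon$ of radius $\epsilon$ centered at $L_4=\left(\frac{1-2\mu}{2},\frac{\sqrt3}{2}\right)$ must orbit clockwise. The same result holds with $L_4$ replaced by $L_5=\left(\frac{1-2\mu}{2},-\frac{\sqrt3}{2}\right)$.
   Context: Here $\mu$ is a real number with $0<\mu\le \frac12$ (mass parameter of the planar circular restricted three body problem, in rotating coordinates). On $\mathbb{R}^2\setminus\{(-\mu,0),(1-\mu,0)\}$ define $$\omega(y_1,y_2)=\frac12(y_1^2+y_2^2)+\frac{1-\mu}{\sqrt{(y_1+\mu)^2+y_2^2}}+\frac{\mu}{\sqrt{(y_1+\mu-1)^2+y_2^2}}.$$ For every solution of the differential equation the quantity $-\dot y_1^2-\dot y_2^2+2\omega(y_1,y_2)$ is a constant $C$, called its Jacobian integral. $L_4$ and $L_5$ are the triangular Lagrangian points (critical points of $\omega$ at distance $1$ from both $(-\mu,0)$ and $(1-\mu,0)$), and $2\omega(L_4)=2\omega(L_5)=C_0$. Meaning of the orientation: the paper speaks of clockwise/counterclockwise motion for the following closed orbits. A simple regular periodic solution (injective on $[0,T)$, $T$ its period, with nonvanishing velocity) orbits clockwise if it traverses the boundary of the region it encloses clockwise. More generally, for a positive integer $n$, a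 closed curve $\alpha:[0,T]\to\mathbb{R}^2$ is $n$-simple around a point $p$ if, identifying $\mathbb{R}^2$ with $\mathbb{C}$, $\alpha(t)=p+(\beta(t)-p)^n$ for some simple regular closed curve $\beta:[0,T]\to\mathbb{R}^2$ whose enclosed region contains $p$ (the lifting of $\alpha$); such an $\alpha$ orbits clockwise if $\beta$ traverses the boundary of its enclosed region clockwise. The theorem is about periodic solutions whose orientation is defined in this sense. *)

theory Defs
  imports "HOL-Complex_Analysis.Complex_Analysis"
begin

text \<open>The planar circular restricted three body problem in rotating coordinates.
  The plane is identified with the complex numbers; \<open>\<mu>\<close> is the mass parameter.\<close>

definition omega :: "real \<Rightarrow> real \<Rightarrow> real \<Rightarrow> real" where
  "omega \<mu> y1 y2 =
     (y1\<^sup>2 + y2\<^sup>2) / 2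
     + (1 - \<mu>) / sqrt ((y1 + \<mu>)\<^sup>2 + y2\<^sup>2)
     + \<mu> / sqrt ((y1 + \<mu> - 1)\<^sup>2 + y2\<^sup>2)"

definition L4 :: "real \<Rightarrow> complex" where
  "L4 \<mu> = Complex ((1 - 2 * \<mu>) / 2) (sqrt 3 / 2)"

definition L5 :: "real \<Rightarrow> complex" where
  "L5 \<mu> = Complex ((1 - 2 * \<mu>) / 2) (- sqrt 3 / 2)"

text \<open>Collisions are excluded explicitly, because division by zero would otherwise give
  \<^const>\<open>omega\<close> a meaningless value at the two primaries.\<close>

definition solution :: "real \<Rightarrow> (real \<Rightarrow> real) \<Rightarrow> (real \<Rightarrow> real) \<Rightarrow> bool" where
  "solution \<mu> y1 y2 \<longleftrightarrow>
     (\<forall>t. (y1 t, y2 t) \<notin> {(- \<mu>, 0), (1 - \<mu>, 0)}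
        \<and> y1 differentiable (at t) \<and> y2 differentiable (at t)
        \<and> (deriv y1 has_real_derivative
              deriv (\<lambda>u. omega \<mu> u (y2 t)) (y1 t) + 2 * deriv y2 t) (at t)
        \<and> (deriv y2 has_real_derivative
              deriv (\<lambda>u. omega \<mu> (y1 t) u) (y2 t) - 2 * deriv y1 t) (at t))"

text \<open>The number \<open>T\<close> is a period, not necessarily the least one.\<close>

definition periodic_solution :: "real \<Rightarrow> real \<Rightarrow> (real \<Rightarrow> real) \<Rightarrow> (real \<Rightarrow> real) \<Rightarrow> bool" where
  "periodic_solution \<mu> T y1 y2 \<longleftrightarrow>
     solution \<mu> y1 y2 \<and> 0 < T \<and> (\<forall>t. y1 (t + T) = y1 t \<and> y2 (t + T) = y2 t)"

definition has_jacobian_integral ::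
    "real \<Rightarrow> (real \<Rightarrow> real) \<Rightarrow> (real \<Rightarrow> real) \<Rightarrow> real \<Rightarrow> bool" where
  "has_jacobian_integral \<mu> y1 y2 C \<longleftrightarrow>
     (\<forall>t. - (deriv y1 t)\<^sup>2 - (deriv y2 t)\<^sup>2 + 2 * omega \<mu> (y1 t) (y2 t) = C)"

text \<open>Closed curves are parametrised over \<open>[0,T]\<close>; values outside this interval are irrelevant.
  The velocity is continuous, nowhere zero, and matches at the two end points.\<close>

definition simple_regular_closed_curve :: "real \<Rightarrow> (real \<Rightarrow> complex) \<Rightarrow> bool" where
  "simple_regular_closed_curve T \<beta> \<longleftrightarrow>
     0 < T \<and> \<beta> T = \<beta> 0 \<and> inj_on \<beta> {0..<T} \<and>
     (\<exists>v. continuous_on {0..T} v \<and> v T = v 0 \<and>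
        (\<forall>t\<in>{0..T}. (\<beta> has_vector_derivative v t) (at t within {0..T}) \<and> v t \<noteq> 0))"

definition enclosed_region :: "real \<Rightarrow> (real \<Rightarrow> complex) \<Rightarrow> complex set" where
  "enclosed_region T \<beta> = inside (\<beta> ` {0..T})"

text \<open>Used for simple closed curves only. The reparametrisation to \<open>[0,1]\<close> is the convention
  of \<^const>\<open>winding_number\<close>.\<close>

definition traverses_clockwise :: "real \<Rightarrow> (real \<Rightarrow> complex) \<Rightarrow> bool" where
  "traverses_clockwise T \<beta> \<longleftrightarrow>
     (\<forall>z\<in>enclosed_region T \<beta>. winding_number (\<lambda>s. \<beta> (T * s)) z = - 1)"

definition n_simple_lifting ::
    "nat \<Rightarrow> complex \<Rightarrow> real \<Rightarrow> (real \<Rightarrow> complex) \<Rightarrow> (real \<Rightarrow> complex) \<Rightarrow> bool" where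
  "n_simple_lifting n p T \<alpha> \<beta> \<longleftrightarrow>
     0 < n \<and> simple_regular_closed_curve T \<beta> \<and> p \<in> enclosed_region T \<beta> \<and>
     (\<forall>t\<in>{0..T}. \<alpha> t = p + (\<beta> t - p) ^ n)"

definition n_simple_around :: "nat \<Rightarrow> complex \<Rightarrow> real \<Rightarrow> (real \<Rightarrow> complex) \<Rightarrow> bool" where
  "n_simple_around n p T \<alpha> \<longleftrightarrow> (\<exists>\<beta>. n_simple_lifting n p T \<alpha> \<beta>)"

definition has_orientation :: "real \<Rightarrow> (real \<Rightarrow> complex) \<Rightarrow> bool" where
  "has_orientation T \<alpha> \<longleftrightarrow>
     simple_regular_closed_curve T \<alpha> \<or> (\<exists>n p. n_simple_around n p T \<alpha>)"

text \<open>A curve may be \<open>n\<close>-simple around several points and have several liftings. All of them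
  are required to be clockwise, so that no independence of the choice is presupposed.\<close>

definition orbits_clockwise :: "real \<Rightarrow> (real \<Rightarrow> complex) \<Rightarrow> bool" where
  "orbits_clockwise T \<alpha> \<longleftrightarrow>
     has_orientation T \<alpha> \<and>
     (simple_regular_closed_curve T \<alpha> \<longrightarrow> traverses_clockwise T \<alpha>) \<and>
     (\<forall>n p \<beta>. n_simple_lifting n p T \<alpha> \<beta> \<longrightarrow> traverses_clockwise T \<beta>)"

end

theory Submission imports Defs begin

text \<open>
  Write \<open>h = \<alpha> - L\<close> for a triangular point \<open>L\<close> and \<open>v\<close> for the velocity. Differentiating
  \<open>h \<bullet> v\<close>, up to terms that are themselves derivatives of periodic functions, gives
  \<open>\<bar>v\<bar>\<^sup>2 + h \<bullet> \<nabla>\<omega> - 4 y\<^sub>2 y\<^sub>1'\<close>. As \<open>L\<close> is a strict nondegenerate minimum of \<open>\<omega>\<close>,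
  \<open>h \<bullet> \<nabla>\<omega> > 0\<close> off \<open>L\<close>, and as \<open>C \<noteq> C\<^sub>0\<close> the orbit is not at rest in \<open>L\<close>. So
  \<open>\<integral> y\<^sub>2 dy\<^sub>1 > 0\<close> over a period: the signed area, i.e. the integral of the winding number of
  \<open>\<alpha>\<close> over the plane, is negative. If a lifting \<open>\<beta>\<close> had winding number \<open>1\<close> around its inside, the
  argument principle would make all winding numbers of \<open>\<alpha> = p + (\<beta> - p)^n\<close> nonnegative.

  The area formula is obtained by applying Fubini's theorem to the Cauchy kernel
  \<open>1 / (\<zeta> - x - \<i> y)\<close>, integrated over the curve in \<open>\<zeta>\<close> and over a square in \<open>(x, y)\<close>.
\<close>

subsection \<open>Area and winding numbers\<close>

lemma nn_integral_inverse_sqrt: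
  assumes "0 \<le> (c::real)"
  shows "(\<integral>\<^sup>+x. ennreal (indicator {0..c} x * x powr (-1/2)) \<partial>lborel) = ennreal (2 * sqrt c)"
proof -
  have "((\<lambda>x. x powr (-1/2)) has_integral 2 * sqrt c) {0..c}"
    using has_integral_powr_from_0[of "-1/2" c] assms by (simp add: powr_half_sqrt mult.commute)
  from nn_integral_has_integral_lebesgue[OF _ this] show ?thesis by simp
qed

text \<open>The singularity at \<open>c\<close> cuts the interval into two pieces of length at most
  \<open>2 * R\<close>; a reflection or a translation moves each into the one-sided case.\<close>

lemma nn_integral_inverse_sqrt_shifted:
  fixes c R :: real
  assumes "\<bar>c\<bar> \<le> R"
  shows "(\<integral>\<^sup>+x. ennreal (indicator {-R..R} x * \<bar>c - x\<bar> powr (-1/2)) \<partial>lborel) \<le> ennreal (4 * sqrt (2 * R))"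
proof -
  define H :: "real \<Rightarrow> ennreal" where "H u = ennreal (indicator {0..2*R} u * u powr (-1/2))" for u
  have [measurable]: "H \<in> borel_measurable borel" unfolding H_def by measurable
  have H: "(\<integral>\<^sup>+x. H x \<partial>lborel) = ennreal (2 * sqrt (2 * R))"
    unfolding H_def using nn_integral_inverse_sqrt[of "2 * R"] assms by auto
  have "ennreal (indicator {-R..R} x * \<bar>c - x\<bar> powr (-1/2)) \<le> H (c - x) + H (x - c)" for x
    using assms by (cases "x \<le> c") (auto simp: H_def indicator_def)
  then have "(\<integral>\<^sup>+x. ennreal (indicator {-R..R} x * \<bar>c - x\<bar> powr (-1/2)) \<partial>lborel)
      \<le> (\<integral>\<^sup>+x. H (c - x) + H (x - c) \<partial>lborel)"
    by (intro nn_integral_mono)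
  also have "\<dots> = (\<integral>\<^sup>+x. H (c - x) \<partial>lborel) + (\<integral>\<^sup>+x. H (x - c) \<partial>lborel)"
    by (intro nn_integral_add) auto
  also have "(\<integral>\<^sup>+x. H (c - x) \<partial>lborel) = (\<integral>\<^sup>+x. H x \<partial>lborel)"
    using nn_integral_real_affine[of H "-1" c] by simp
  also have "(\<integral>\<^sup>+x. H (x - c) \<partial>lborel) = (\<integral>\<^sup>+x. H x \<partial>lborel)"
    using nn_integral_real_affine[of H "1" "-c"] by simp
  finally show ?thesis using assms by (simp add: H ennreal_plus[symmetric] del: ennreal_plus)
qed

text \<open>Restriction to a square makes the kernel integrable in \<open>(x, y)\<close>; at the
  pole the convention \<open>1 / 0 = 0\<close> gives the value 0.\<close>

definition cauchy_kernel :: "real \<Rightarrow> complex \<Rightarrow> real \<Rightarrow> real \<Rightarrow> complex" where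
  "cauchy_kernel R \<zeta> x y =
     (indicator {-R..R} x * indicator {-R..R} y) *\<^sub>R (1 / (\<zeta> - Complex x y))"

lemma Complex_measurable [measurable]:
  assumes [measurable]: "f \<in> borel_measurable M" "g \<in> borel_measurable M"
  shows "(\<lambda>x. Complex (f x) (g x)) \<in> borel_measurable M"
  by (simp add: Complex_eq)

lemma cauchy_kernel_measurable [measurable]:
  assumes [measurable]: "f \<in> borel_measurable M" "g \<in> borel_measurable M" "h \<in> borel_measurable M"
  shows "(\<lambda>x. cauchy_kernel R (f x) (g x) (h x)) \<in> borel_measurable M"
  unfolding cauchy_kernel_def by measurable

text \<open>Since \<open>\<bar>x y\<bar> \<le> \<bar>x + \<i> y\<bar>\<^sup>2\<close>, the kernel is dominated by a product of integrable functions of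
  one variable, which avoids polar coordinates.\<close>

lemma norm_cauchy_kernel_le:
  assumes "x \<noteq> Re \<zeta>" "y \<noteq> Im \<zeta>"
  shows "norm (cauchy_kernel R \<zeta> x y) \<le>
    (indicator {-R..R} x * \<bar>Re \<zeta> - x\<bar> powr (-1/2)) * (indicator {-R..R} y * \<bar>Im \<zeta> - y\<bar> powr (-1/2))"
proof -
  let ?z = "\<zeta> - Complex x y"
  have "\<bar>Re \<zeta> - x\<bar> * \<bar>Im \<zeta> - y\<bar> \<le> cmod ?z * cmod ?z"
    using abs_Re_le_cmod[of ?z] abs_Im_le_cmod[of ?z] by (intro mult_mono) auto
  then have "sqrt (\<bar>Re \<zeta> - x\<bar> * \<bar>Im \<zeta> - y\<bar>) \<le> cmod ?z"
    by (metis norm_ge_zero power2_eq_square real_le_lsqrt)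
  moreover have "0 < \<bar>Re \<zeta> - x\<bar> * \<bar>Im \<zeta> - y\<bar>" using assms by simp
  ultimately have "1 / cmod ?z \<le> 1 / sqrt (\<bar>Re \<zeta> - x\<bar> * \<bar>Im \<zeta> - y\<bar>)"
    by (intro divide_left_mono) (auto intro!: mult_pos_pos order.strict_trans2[OF _ \<open>sqrt _ \<le> _\<close>])
  also have "\<dots> = \<bar>Re \<zeta> - x\<bar> powr (-1/2) * \<bar>Im \<zeta> - y\<bar> powr (-1/2)"
    using assms by (simp add: powr_minus powr_half_sqrt real_sqrt_mult divide_simps)
  finally show ?thesis
    by (auto simp: cauchy_kernel_def norm_divide indicator_def)
qed

text \<open>The bound does not depend on \<open>\<zeta>\<close>, as Fubini along a whole curve
  requires. It is the product of two one-dimensional bounds \<open>4 * sqrt (2 * R)\<close>.\<close>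

lemma nn_integral_cauchy_kernel_le:
  assumes "\<bar>Re \<zeta>\<bar> \<le> R" "\<bar>Im \<zeta>\<bar> \<le> R"
  shows "(\<integral>\<^sup>+z. ennreal (norm (cauchy_kernel R \<zeta> (fst z) (snd z))) \<partial>(lborel \<Otimes>\<^sub>M lborel)) \<le> ennreal (32 * R)"
proof -
  define q :: "real \<Rightarrow> real \<Rightarrow> real" where "q c x = indicator {-R..R} x * \<bar>c - x\<bar> powr (-1/2)" for c x
  have q0: "0 \<le> q c x" for c x by (simp add: q_def)
  have [measurable]: "q c \<in> borel_measurable borel" for c unfolding q_def by measurable
  have q: "(\<integral>\<^sup>+x. ennreal (q c x) \<partial>lborel) \<le> ennreal (4 * sqrt (2 * R))" if "\<bar>c\<bar> \<le> R" for c
    using nn_integral_inverse_sqrt_shifted[OF that] by (simp add: q_def)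
  have "(\<integral>\<^sup>+z. ennreal (norm (cauchy_kernel R \<zeta> (fst z) (snd z))) \<partial>(lborel \<Otimes>\<^sub>M lborel))
    = (\<integral>\<^sup>+x. \<integral>\<^sup>+y. ennreal (norm (cauchy_kernel R \<zeta> x y)) \<partial>lborel \<partial>lborel)"
    by (subst lborel.nn_integral_fst[symmetric]) simp_all
  also have "\<dots> \<le> (\<integral>\<^sup>+x. \<integral>\<^sup>+y. ennreal (q (Re \<zeta>) x * q (Im \<zeta>) y) \<partial>lborel \<partial>lborel)"
  proof (rule nn_integral_mono_AE)
    \<comment> \<open>The lines through \<open>\<zeta>\<close> parallel to the axes are left out:
      there \<open>0 powr (-1/2) = 0\<close> spoils the domination.\<close>
    show "AE x in lborel. (\<integral>\<^sup>+y. ennreal (norm (cauchy_kernel R \<zeta> x y)) \<partial>lborel) \<le>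
        (\<integral>\<^sup>+y. ennreal (q (Re \<zeta>) x * q (Im \<zeta>) y) \<partial>lborel)"
      using AE_lborel_singleton[of "Re \<zeta>"]
    proof eventually_elim
      case (elim x)
      show ?case
      proof (rule nn_integral_mono_AE)
        show "AE y in lborel. ennreal (norm (cauchy_kernel R \<zeta> x y)) \<le> ennreal (q (Re \<zeta>) x * q (Im \<zeta>) y)"
          using AE_lborel_singleton[of "Im \<zeta>"]
          by eventually_elim (use elim norm_cauchy_kernel_le[of x \<zeta> _ R] in \<open>auto simp: q_def intro!: ennreal_leI\<close>)
      qed
    qed
  qed
  also have "\<dots> = (\<integral>\<^sup>+x. ennreal (q (Re \<zeta>) x) * (\<integral>\<^sup>+y. ennreal (q (Im \<zeta>) y) \<partial>lborel) \<partial>lborel)"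
    by (simp add: ennreal_mult q0 nn_integral_cmult)
  also have "\<dots> = (\<integral>\<^sup>+x. ennreal (q (Re \<zeta>) x) \<partial>lborel) * (\<integral>\<^sup>+y. ennreal (q (Im \<zeta>) y) \<partial>lborel)"
    by (simp add: nn_integral_multc)
  also have "\<dots> \<le> ennreal (4 * sqrt (2 * R)) * ennreal (4 * sqrt (2 * R))"
    by (intro mult_mono q assms) auto
  also have "\<dots> = ennreal (32 * R)"
    using assms by (simp add: ennreal_mult[symmetric])
  finally show ?thesis .
qed

lemma integrable_cauchy_kernel:
  assumes "\<bar>Re \<zeta>\<bar> \<le> R" "\<bar>Im \<zeta>\<bar> \<le> R"
  shows "integrable (lborel \<Otimes>\<^sub>M lborel) (\<lambda>(x, y). cauchy_kernel R \<zeta> x y)"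
proof (rule integrableI_bounded)
  show "(\<integral>\<^sup>+z. ennreal (norm (case z of (x, y) \<Rightarrow> cauchy_kernel R \<zeta> x y)) \<partial>(lborel \<Otimes>\<^sub>M lborel)) < \<infinity>"
    using order.strict_trans1[OF nn_integral_cauchy_kernel_le[OF assms]] by (simp add: case_prod_beta)
qed (simp add: case_prod_beta)

text \<open>The integral of the Cauchy kernel along a horizontal segment is a logarithm. Its part that is
  holomorphic in a strip vanishes over closed curves; only the jump across the cut contributes.\<close>

definition strip_log :: "real \<Rightarrow> complex \<Rightarrow> complex" where
  "strip_log R w = Ln (w + of_real R) - Ln (of_real R - w)"

lemma strip_log_holomorphic: "strip_log R holomorphic_on {w. - R < Re w \<and> Re w < R}"
  unfolding strip_log_def
  by (intro holomorphic_intros) (auto simp: complex_nonpos_Reals_iff)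

lemma integral_cauchy_kernel_slice:
  assumes "\<bar>Re \<zeta>\<bar> < R" "y \<noteq> Im \<zeta>"
  shows "(\<integral>x. cauchy_kernel R \<zeta> x y \<partial>lborel) =
    indicator {-R..R} y *\<^sub>R (strip_log R (\<zeta> - \<i> * y) - \<i> * pi * sgn (Im \<zeta> - y))"
proof -
  have R: "0 < R" using assms by linarith
  define c where "c = \<zeta> - \<i> * y"
  have c: "Re c = Re \<zeta>" "Im c = Im \<zeta> - y" by (auto simp: c_def)
  have nz: "c - of_real x \<noteq> 0" for x using assms c by (auto simp: complex_eq_iff)
  \<comment> \<open>\<open>- Ln (c - x)\<close> is a primitive along the segment because
    \<open>Im c \<noteq> 0\<close> keeps it off the cut of \<open>Ln\<close>.\<close>
  have "(\<integral>x. indicator {-R..R} x *\<^sub>R (1 / (c - of_real x)) \<partial>lborel) = - Ln (c - of_real R) - (- Ln (c - of_real (-R)))"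
  proof (rule integral_FTC_Icc)
    fix x
    have "c - of_real x \<notin> \<real>\<^sub>\<le>\<^sub>0" using assms c by (auto simp: complex_nonpos_Reals_iff)
    then have "((\<lambda>u. - Ln (c - u)) has_field_derivative 1 / (c - of_real x)) (at (of_real x))"
      by (auto intro!: derivative_eq_intros simp: divide_inverse)
    then show "((\<lambda>u. - Ln (c - of_real u)) has_vector_derivative 1 / (c - of_real x)) (at x within {-R..R})"
      by (rule has_vector_derivative_at_within[OF has_vector_derivative_real_field])
  qed (use R nz in \<open>auto intro!: continuous_intros\<close>)
  \<comment> \<open>\<open>Ln (R - c)\<close> is holomorphic for \<open>c\<close> in the strip;
    replacing \<open>Ln (c - R)\<close> by it costs \<open>\<i> * pi\<close> with the sign of
    \<open>Im c\<close>.\<close>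
  also have "Ln (c - of_real R) = Ln (- (of_real R - c))" by simp
  also have "\<dots> = Ln (of_real R - c) + \<i> * pi * sgn (Im \<zeta> - y)"
    using Ln_minus[of "of_real R - c"] nz[of R] assms c by (auto simp: sgn_if)
  finally have "(\<integral>x. indicator {-R..R} x *\<^sub>R (1 / (c - of_real x)) \<partial>lborel)
    = strip_log R c - \<i> * pi * sgn (Im \<zeta> - y)" by (simp add: strip_log_def)
  moreover have "cauchy_kernel R \<zeta> x y = indicator {-R..R} y *\<^sub>R (indicator {-R..R} x *\<^sub>R (1 / (c - of_real x)))" for x
    by (simp add: cauchy_kernel_def c_def Complex_eq algebra_simps)
  ultimately show ?thesis by (simp only: integral_scaleR_right) (simp add: c_def)
qed

lemma has_integral_sgn_diff:
  assumes "\<bar>b\<bar> \<le> (R::real)"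
  shows "((\<lambda>y. complex_of_real (sgn (b - y))) has_integral of_real (2 * b)) {-R..R}"
proof -
  have "((\<lambda>y. 1::real) has_integral (b + R)) {-R..b}"
    using has_integral_const_real[of "1::real" "-R" b] assms by (simp add: abs_le_iff)
  then have 1: "((\<lambda>y. sgn (b - y)) has_integral (b + R)) {-R..b}"
    by (rule has_integral_spike_finite[of "{b}", rotated 2]) auto
  have "((\<lambda>y. -1::real) has_integral (b - R)) {b..R}"
    using has_integral_const_real[of "-1::real" b R] assms by (simp add: abs_le_iff)
  then have 2: "((\<lambda>y. sgn (b - y)) has_integral (b - R)) {b..R}"
    by (rule has_integral_spike_finite[of "{b}", rotated 2]) auto
  have "((\<lambda>y. sgn (b - y)) has_integral (b + R) + (b - R)) {-R..R}"
    using assms by (intro has_integral_combine[OF _ _ 1 2]) auto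
  from has_integral_of_real[OF this, where 'b=complex] show ?thesis by simp
qed

text \<open>When the slices are integrated over \<open>y\<close>, the jumps contribute
  \<open>2 * Im \<zeta>\<close> times \<open>\<i> * pi\<close>. This subtracted term is the only one
  not holomorphic in \<open>\<zeta>\<close>, and it will carry the area.\<close>

lemma integral_cauchy_kernel:
  assumes "\<bar>Re \<zeta>\<bar> < R" "\<bar>Im \<zeta>\<bar> < R"
  shows "(\<integral>z. cauchy_kernel R \<zeta> (fst z) (snd z) \<partial>(lborel \<Otimes>\<^sub>M lborel)) =
    integral {-R..R} (\<lambda>y. strip_log R (\<zeta> - \<i> * complex_of_real y)) - 2 * pi * \<i> * Im \<zeta>"
proof -
  let ?h = "\<lambda>y. strip_log R (\<zeta> - \<i> * complex_of_real y) - \<i> * pi * sgn (Im \<zeta> - y)"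
  have int: "integrable (lborel \<Otimes>\<^sub>M lborel) (\<lambda>(x, y). cauchy_kernel R \<zeta> x y)"
    using integrable_cauchy_kernel assms by simp
  have "(\<integral>z. cauchy_kernel R \<zeta> (fst z) (snd z) \<partial>(lborel \<Otimes>\<^sub>M lborel)) = (\<integral>y. \<integral>x. cauchy_kernel R \<zeta> x y \<partial>lborel \<partial>lborel)"
    using lborel_pair.integral_snd[OF int] by (simp add: case_prod_beta')
  also have "\<dots> = (\<integral>y. indicator {-R..R} y *\<^sub>R ?h y \<partial>lborel)"
  proof (rule integral_cong_AE)
    show "AE y in lborel. (\<integral>x. cauchy_kernel R \<zeta> x y \<partial>lborel) = indicator {-R..R} y *\<^sub>R ?h y"
      using AE_lborel_singleton[of "Im \<zeta>"]
      by eventually_elim (use assms integral_cauchy_kernel_slice in auto)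
  qed (auto simp: strip_log_def)
  also have "\<dots> = integral {-R..R} ?h"
  proof -
    \<comment> \<open>Fubini also supplies the integrability of \<open>?h\<close> needed for passing
      to the gauge integral.\<close>
    have "integrable lborel (\<lambda>y. \<integral>x. cauchy_kernel R \<zeta> x y \<partial>lborel)"
      by (rule lborel_pair.integrable_snd[OF int])
    also have "?this \<longleftrightarrow> set_integrable lborel {-R..R} ?h" unfolding set_integrable_def
    proof (rule integrable_cong_AE)
      show "AE y in lborel. (\<integral>x. cauchy_kernel R \<zeta> x y \<partial>lborel) = indicator {-R..R} y *\<^sub>R ?h y"
        using AE_lborel_singleton[of "Im \<zeta>"]
        by eventually_elim (use assms integral_cauchy_kernel_slice in auto)
    qed (auto simp: strip_log_def)
    finally have "set_integrable lborel {-R..R} ?h" .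
    from set_borel_integral_eq_integral(2)[OF this] show ?thesis
      by (simp only: set_lebesgue_integral_def)
  qed
  also have "\<dots> = integral {-R..R} (\<lambda>y. strip_log R (\<zeta> - \<i> * complex_of_real y)) - 2 * pi * \<i> * Im \<zeta>"
  proof -
    have "continuous_on {-R..R} (\<lambda>y. strip_log R (\<zeta> - \<i> * of_real y))"
      by (rule continuous_on_compose2[OF holomorphic_on_imp_continuous_on[OF strip_log_holomorphic]])
         (use assms in \<open>auto intro!: continuous_intros simp: abs_less_iff\<close>)
    then have "((\<lambda>y. strip_log R (\<zeta> - \<i> * complex_of_real y)) has_integral integral {-R..R} (\<lambda>y. strip_log R (\<zeta> - \<i> * complex_of_real y))) {-R..R}"
      by (intro integrable_integral integrable_continuous_interval)
    moreover have "((\<lambda>y. (\<i> * pi) * complex_of_real (sgn (Im \<zeta> - y))) has_integral (\<i> * pi) * of_real (2 * Im \<zeta>)) {-R..R}"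
      by (intro has_integral_mult_right has_integral_sgn_diff) (use assms in auto)
    ultimately have "(?h has_integral integral {-R..R} (\<lambda>y. strip_log R (\<zeta> - \<i> * complex_of_real y)) - (\<i> * pi) * of_real (2 * Im \<zeta>)) {-R..R}"
      by (rule has_integral_diff)
    from integral_unique[OF this] show ?thesis by simp
  qed
  finally show ?thesis .
qed

section \<open>Area enclosed by a closed C1 curve\<close>

text \<open>At the end points only one-sided derivatives are available, so both enter the finite
  exceptional set that \<open>valid_path\<close> permits.\<close>

lemma valid_path_C1:
  assumes der: "\<And>t. t \<in> {0..1} \<Longrightarrow> (g has_vector_derivative v t) (at t within {0..1})"
    and v: "continuous_on {0..1} v"
  shows "valid_path g"
proof -
  have "continuous_on {0..1} g"
    using der has_vector_derivative_continuous continuous_on_eq_continuous_within by blast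
  moreover have "g C1_differentiable_on ({0..1} - {0, 1})"
    unfolding C1_differentiable_on_def
  proof (intro exI[of _ v] conjI ballI)
    fix t :: real assume t: "t \<in> {0..1} - {0, 1}"
    then have "at t within {0..1} = at t"
      by (intro at_within_interior) auto
    then show "(g has_vector_derivative v t) (at t)" using der[of t] t by auto
  qed (rule continuous_on_subset[OF v], auto)
  ultimately show ?thesis
    unfolding valid_path_def piecewise_C1_differentiable_on_def by (intro conjI exI[of _ "{0,1}"]) auto
qed

text \<open>Fubini exchanges the square with the curve: inside then stands
  \<open>integral_cauchy_kernel\<close>, whose holomorphic part vanishes by Cauchy's theorem on the
  closed curve. Inside the square and off the curve, \<open>Z\<close> is
  \<open>2 * pi * \<i>\<close> times the winding number.\<close>

lemma integral_contour_cauchy_kernel: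
  fixes g v :: "real \<Rightarrow> complex" and R :: real
  defines "Z \<equiv> \<lambda>z. \<integral>t. indicator {0..1} t *\<^sub>R (v t * cauchy_kernel R (g t) (fst z) (snd z)) \<partial>lborel"
  assumes der: "\<And>t. t \<in> {0..1} \<Longrightarrow> (g has_vector_derivative v t) (at t within {0..1})"
    and v: "continuous_on {0..1} v" and closed: "g 1 = g 0"
    and R: "\<And>t. t \<in> {0..1} \<Longrightarrow> \<bar>Re (g t)\<bar> < R \<and> \<bar>Im (g t)\<bar> < R"
  shows "integrable (lborel \<Otimes>\<^sub>M lborel) Z"
    and "(\<integral>z. Z z \<partial>(lborel \<Otimes>\<^sub>M lborel)) = - 2 * pi * \<i> * integral {0..1} (\<lambda>t. v t * Im (g t))"
proof -
  have g: "continuous_on {0..1} g"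
    using der has_vector_derivative_continuous continuous_on_eq_continuous_within by blast
  \<comment> \<open>The cut-off functions are Borel measurable on the whole line, while
    \<open>v\<close> and \<open>g\<close> are constrained on \<open>{0..1}\<close> only.\<close>
  define v' where "v' t = indicator {0..1::real} t *\<^sub>R v t" for t
  define g' where "g' t = indicator {0..1::real} t *\<^sub>R g t" for t
  have [measurable]: "v' \<in> borel_measurable borel" "g' \<in> borel_measurable borel"
    unfolding v'_def g'_def by (simp_all add: borel_measurable_continuous_on_indicator v g)
  define F where "F t z = v' t * cauchy_kernel R (g' t) (fst z) (snd z)" for t z
  have Z: "Z = (\<lambda>z. \<integral>t. F t z \<partial>lborel)"
    unfolding Z_def F_def v'_def g'_def
    by (intro ext Bochner_Integration.integral_cong refl) (simp add: indicator_def)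
  obtain V where V: "\<And>t. t \<in> {0..1} \<Longrightarrow> norm (v t) \<le> V"
    using compact_imp_bounded[OF compact_continuous_image[OF v compact_Icc]] by (metis bounded_iff image_eqI)
  have R0: "0 < R" using R[of 0] by auto
  have V0: "0 \<le> V" using V[of 0] by (auto intro: order_trans[OF norm_ge_zero])
  have int: "integrable (lborel \<Otimes>\<^sub>M (lborel \<Otimes>\<^sub>M lborel)) (\<lambda>(t, z). F t z)"
  proof (rule integrableI_bounded)
    show "(\<lambda>(t, z). F t z) \<in> borel_measurable (lborel \<Otimes>\<^sub>M (lborel \<Otimes>\<^sub>M lborel))"
      unfolding F_def by measurable
    have "(\<integral>\<^sup>+p. norm (case p of (t, z) \<Rightarrow> F t z) \<partial>(lborel \<Otimes>\<^sub>M (lborel \<Otimes>\<^sub>M lborel)))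
      = (\<integral>\<^sup>+t. \<integral>\<^sup>+z. norm (F t z) \<partial>(lborel \<Otimes>\<^sub>M lborel) \<partial>lborel)"
      by (subst lborel_pair.P.nn_integral_fst[symmetric]) (simp_all add: F_def case_prod_beta)
    also have "\<dots> \<le> (\<integral>\<^sup>+t. ennreal (V * (32 * R)) * indicator {0..1::real} t \<partial>lborel)"
    proof (rule nn_integral_mono)
      fix t :: real
      show "(\<integral>\<^sup>+z. norm (F t z) \<partial>(lborel \<Otimes>\<^sub>M lborel)) \<le> ennreal (V * (32 * R)) * indicator {0..1} t"
      proof (cases "t \<in> {0..1}")
        case True
        have "(\<integral>\<^sup>+z. norm (F t z) \<partial>(lborel \<Otimes>\<^sub>M lborel))
          = ennreal (norm (v t)) * (\<integral>\<^sup>+z. norm (cauchy_kernel R (g t) (fst z) (snd z)) \<partial>(lborel \<Otimes>\<^sub>M lborel))"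
          using True by (simp add: F_def v'_def g'_def norm_mult ennreal_mult nn_integral_cmult)
        also have "\<dots> \<le> ennreal V * ennreal (32 * R)"
          using True R[OF True] by (intro mult_mono ennreal_leI V nn_integral_cauchy_kernel_le) auto
        finally show ?thesis using True V0 R0 by (simp add: ennreal_mult)
      qed (simp add: F_def v'_def)
    qed
    also have "\<dots> < \<infinity>"
      by (simp add: nn_integral_cmult ennreal_mult_less_top)
    finally show "(\<integral>\<^sup>+p. norm (case p of (t, z) \<Rightarrow> F t z) \<partial>(lborel \<Otimes>\<^sub>M (lborel \<Otimes>\<^sub>M lborel))) < \<infinity>" .
  qed
  interpret P: pair_sigma_finite lborel "lborel \<Otimes>\<^sub>M lborel" ..
  show "integrable (lborel \<Otimes>\<^sub>M lborel) Z"
    using P.integrable_snd[OF int] by (simp add: Z)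
  define \<Psi> where "\<Psi> \<zeta> = integral {-R..R} (\<lambda>y. strip_log R (\<zeta> - \<i> * complex_of_real y))" for \<zeta>
  have cont: "continuous_on (cbox (0, -R) (1, R)) (\<lambda>(t, y). v t * strip_log R (g t - \<i> * complex_of_real y))"
    unfolding case_prod_beta
  proof (rule continuous_on_mult)
    have fst: "continuous_on (cbox (0, -R) (1, R)) (fst :: real \<times> real \<Rightarrow> real)"
      "fst ` cbox (0 :: real, -R) (1, R) \<subseteq> {0..1}" by (auto intro!: continuous_intros)
    show "continuous_on (cbox (0, -R) (1, R)) (\<lambda>x. v (fst x))"
      by (rule continuous_on_compose2[OF v fst])
    have "continuous_on (cbox (0, -R) (1, R)) (\<lambda>x. g (fst x))"
      by (rule continuous_on_compose2[OF g fst])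
    then have "continuous_on (cbox (0, -R) (1, R)) (\<lambda>x. g (fst x) - \<i> * complex_of_real (snd x))"
      by (intro continuous_intros)
    then show "continuous_on (cbox (0, -R) (1, R)) (\<lambda>x. strip_log R (g (fst x) - \<i> * complex_of_real (snd x)))"
      by (rule continuous_on_compose2[OF holomorphic_on_imp_continuous_on[OF strip_log_holomorphic]])
         (use R in \<open>auto simp: abs_less_iff minus_less_iff\<close>)
  qed
  \<comment> \<open>The integral over \<open>y\<close> is pulled outside, so that Cauchy's theorem
    applies for each fixed \<open>y\<close>; subtracting \<open>\<i> * y\<close> preserves the
    vertical strip.\<close>
  have \<Psi>0: "integral {0..1} (\<lambda>t. v t * \<Psi> (g t)) = 0"
  proof -
    have "integral {0..1} (\<lambda>t. v t * \<Psi> (g t))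
      = integral (cbox 0 1) (\<lambda>t. integral (cbox (-R) R) (\<lambda>y. v t * strip_log R (g t - \<i> * complex_of_real y)))"
      by (simp add: \<Psi>_def)
    also have "\<dots> = integral (cbox (-R) R) (\<lambda>y. integral (cbox 0 1) (\<lambda>t. v t * strip_log R (g t - \<i> * complex_of_real y)))"
      using integral_swap_continuous[OF cont] .
    also have "\<dots> = integral (cbox (-R) R) (\<lambda>y. 0)"
    proof (rule integral_cong)
      fix y
      have "((\<lambda>w. strip_log R (w - \<i> * complex_of_real y)) has_contour_integral 0) g"
      proof (rule Cauchy_theorem_convex_simple[of _ "{w. - R < Re w \<and> Re w < R}"])
        show "(\<lambda>w. strip_log R (w - \<i> * complex_of_real y)) holomorphic_on {w. - R < Re w \<and> Re w < R}"
          by (rule holomorphic_on_compose_gen[OF _ strip_log_holomorphic, unfolded o_def])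
             (auto intro!: holomorphic_intros)
        show "convex {w. - R < Re w \<and> Re w < R}"
          by (auto intro!: convex_Int convex_halfspace_Re_gt convex_halfspace_Re_lt simp: Collect_conj_eq)
        show "valid_path g" using valid_path_C1[OF der v] .
        show "path_image g \<subseteq> {w. - R < Re w \<and> Re w < R}"
          using R by (auto simp: path_image_def abs_less_iff minus_less_iff)
        show "pathfinish g = pathstart g" using closed by (simp add: pathfinish_def pathstart_def)
      qed
      then have "((\<lambda>t. strip_log R (g t - \<i> * complex_of_real y) * vector_derivative g (at t within {0..1})) has_integral 0) {0..1}"
        by (simp add: has_contour_integral_def)
      then have "((\<lambda>t. v t * strip_log R (g t - \<i> * complex_of_real y)) has_integral 0) {0..1}"
        by (rule has_integral_eq[rotated])
           (use der in \<open>simp add: vector_derivative_within_closed_interval mult.commute\<close>)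
      then show "integral (cbox 0 1) (\<lambda>t. v t * strip_log R (g t - \<i> * complex_of_real y)) = 0"
        by (simp add: integral_unique)
    qed
    finally show ?thesis by simp
  qed
  have "(\<integral>z. Z z \<partial>(lborel \<Otimes>\<^sub>M lborel)) = (\<integral>t. \<integral>z. F t z \<partial>(lborel \<Otimes>\<^sub>M lborel) \<partial>lborel)"
    unfolding Z by (rule P.Fubini_integral[OF int])
  also have "\<dots> = (\<integral>t. indicator {0..1} t *\<^sub>R (v t * (\<Psi> (g t) - 2 * pi * \<i> * Im (g t))) \<partial>lborel)"
    using R by (intro Bochner_Integration.integral_cong) (auto simp: indicator_def F_def v'_def g'_def integral_cauchy_kernel \<Psi>_def)
  also have "\<dots> = integral {0..1} (\<lambda>t. v t * (\<Psi> (g t) - 2 * pi * \<i> * Im (g t)))"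
  proof -
    have "integrable lborel (\<lambda>t. \<integral>z. F t z \<partial>(lborel \<Otimes>\<^sub>M lborel))"
      by (rule P.integrable_fst[OF int])
    also have "(\<lambda>t. \<integral>z. F t z \<partial>(lborel \<Otimes>\<^sub>M lborel))
        = (\<lambda>t. indicator {0..1} t *\<^sub>R (v t * (\<Psi> (g t) - 2 * pi * \<i> * Im (g t))))"
      using R by (intro ext) (auto simp: indicator_def F_def v'_def g'_def integral_cauchy_kernel \<Psi>_def)
    finally have "set_integrable lborel {0..1} (\<lambda>t. v t * (\<Psi> (g t) - 2 * pi * \<i> * Im (g t)))"
      by (simp add: set_integrable_def)
    from set_borel_integral_eq_integral(2)[OF this] show ?thesis by (simp add: set_lebesgue_integral_def)
  qed
  also have "\<dots> = integral {0..1} (\<lambda>t. v t * \<Psi> (g t)) - integral {0..1} (\<lambda>t. 2 * pi * \<i> * (v t * Im (g t)))"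
  proof -
    from cont have "continuous_on ({0..1} \<times> cbox (-R) R) (\<lambda>(t, y). v t * strip_log R (g t - \<i> * complex_of_real y))"
      by (simp add: cbox_Pair_eq)
    from integral_continuous_on_param[OF this]
    have "(\<lambda>t. v t * \<Psi> (g t)) integrable_on {0..1}"
      by (simp add: \<Psi>_def integrable_continuous_interval)
    moreover have "(\<lambda>t. 2 * pi * \<i> * (v t * Im (g t))) integrable_on {0..1}"
      by (intro integrable_continuous_interval continuous_intros v g)
    ultimately have "integral {0..1} (\<lambda>t. v t * \<Psi> (g t) - 2 * pi * \<i> * (v t * Im (g t)))
      = integral {0..1} (\<lambda>t. v t * \<Psi> (g t)) - integral {0..1} (\<lambda>t. 2 * pi * \<i> * (v t * Im (g t)))"
      by (rule Henstock_Kurzweil_Integration.integral_diff)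
    moreover have "v t * (\<Psi> (g t) - 2 * pi * \<i> * Im (g t)) = v t * \<Psi> (g t) - 2 * pi * \<i> * (v t * Im (g t))" for t
      by (simp add: algebra_simps)
    ultimately show ?thesis by simp
  qed
  finally show "(\<integral>z. Z z \<partial>(lborel \<Otimes>\<^sub>M lborel)) = - 2 * pi * \<i> * integral {0..1} (\<lambda>t. v t * Im (g t))"
    by (simp add: \<Psi>0)
qed

text \<open>\<open>Re v * Im g\<close> is the form \<open>y dx\<close>, whose integral over a closed
  curve is minus the signed area. The imaginary part of
  \<open>integral_contour_cauchy_kernel\<close> expresses it by an integral of winding
  numbers.\<close>

lemma integral_Re_Im_nonpos:
  fixes g v :: "real \<Rightarrow> complex"
  assumes der: "\<And>t. t \<in> {0..1} \<Longrightarrow> (g has_vector_derivative v t) (at t within {0..1})"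
    and v: "continuous_on {0..1} v" and closed: "g 1 = g 0"
    and wn: "\<And>z. z \<notin> path_image g \<Longrightarrow> 0 \<le> Re (winding_number g z)"
  shows "integral {0..1} (\<lambda>t. Re (v t) * Im (g t)) \<le> 0"
proof -
  have g: "continuous_on {0..1} g"
    using der has_vector_derivative_continuous continuous_on_eq_continuous_within by blast
  have valid: "valid_path g" by (rule valid_path_C1[OF der v])
  have vd: "vector_derivative g (at t within {0..1}) = v t" if "t \<in> {0..1}" for t
    by (rule vector_derivative_within_closed_interval[OF _ that der[OF that]]) simp
  obtain R where R: "\<And>t. t \<in> {0..1} \<Longrightarrow> norm (g t) < R"
    using compact_imp_bounded[OF compact_continuous_image[OF g compact_Icc]]
    by (meson bounded_pos_less imageI)
  have R': "\<bar>Re (g t)\<bar> < R \<and> \<bar>Im (g t)\<bar> < R" if "t \<in> {0..1}" for t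
    using R[OF that] abs_Re_le_cmod[of "g t"] abs_Im_le_cmod[of "g t"] by linarith
  define Z where "Z z = (\<integral>t. indicator {0..1} t *\<^sub>R (v t * cauchy_kernel R (g t) (fst z) (snd z)) \<partial>lborel)" for z
  have Z: "integrable (lborel \<Otimes>\<^sub>M lborel) Z"
    "(\<integral>z. Z z \<partial>(lborel \<Otimes>\<^sub>M lborel)) = - 2 * pi * \<i> * integral {0..1} (\<lambda>t. v t * Im (g t))"
    unfolding Z_def using integral_contour_cauchy_kernel[OF der v closed R'] by blast+
  let ?S = "(\<lambda>t. (Re (g t), Im (g t))) ` {0..1}"
  \<comment> \<open>A differentiable image of an interval is a null set in the plane, so at almost
    every point the winding number is given by the contour integral.\<close>
  have AE: "AE z in lborel \<Otimes>\<^sub>M lborel. z \<notin> ?S"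
  proof -
    have "(\<lambda>t. (Re (g t), Im (g t))) differentiable_on {0..1}"
      unfolding differentiable_on_def
    proof
      fix t :: real assume "t \<in> {0..1}"
      from der[OF this] have "(g has_derivative (\<lambda>x. x *\<^sub>R v t)) (at t within {0..1})"
        by (simp add: has_vector_derivative_def)
      then show "(\<lambda>t. (Re (g t), Im (g t))) differentiable at t within {0..1}"
        by (auto intro!: differentiableI derivative_eq_intros)
    qed
    then have "negligible ?S"
      by (intro negligible_differentiable_image_lowdim) auto
    \<comment> \<open>Closedness makes the image Borel, hence null for \<open>lborel\<close> and not
      only for its completion.\<close>
    moreover have "closed ?S"
      by (intro compact_imp_closed compact_continuous_image continuous_intros g) simp
    ultimately have "?S \<in> null_sets lborel"
      by (simp add: negligible_iff_null_sets null_sets_completion_iff)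
    then show ?thesis by (simp add: lborel_prod AE_not_in)
  qed
  have "AE z in lborel \<Otimes>\<^sub>M lborel. 0 \<le> Im (Z z)"
    using AE
  proof eventually_elim
    case (elim z)
    let ?z = "Complex (fst z) (snd z)"
    have off: "g t \<noteq> ?z" if "t \<in> {0..1}" for t
      using elim that by (cases z) (auto simp: image_iff complex_eq_iff)
    then have nin: "?z \<notin> path_image g" unfolding path_image_def by (metis imageE)
    \<comment> \<open>The cutoff does not depend on \<open>t\<close> and leaves the integral as a
      nonnegative factor.\<close>
    define c :: real where "c = indicator {-R..R} (fst z) * indicator {-R..R} (snd z)"
    have cont: "continuous_on {0..1} (\<lambda>t. 1 / (g t - ?z) * v t)"
      by (intro continuous_intros g v) (use off in auto)
    have "Z z = c *\<^sub>R (\<integral>t. indicator {0..1} t *\<^sub>R (1 / (g t - ?z) * v t) \<partial>lborel)"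
      unfolding Z_def cauchy_kernel_def c_def
      by (subst Bochner_Integration.integral_scaleR_right[symmetric])
         (simp add: algebra_simps del: Bochner_Integration.integral_scaleR_right)
    also have "(\<integral>t. indicator {0..1} t *\<^sub>R (1 / (g t - ?z) * v t) \<partial>lborel) = integral {0..1} (\<lambda>t. 1 / (g t - ?z) * v t)"
      using set_borel_integral_eq_integral(2)[OF borel_integrable_atLeastAtMost'[OF cont]]
      by (simp only: set_lebesgue_integral_def)
    also have "\<dots> = contour_integral g (\<lambda>w. 1 / (w - ?z))"
    proof (rule contour_integral_unique[symmetric])
      have "((\<lambda>t. 1 / (g t - ?z) * v t) has_integral integral {0..1} (\<lambda>t. 1 / (g t - ?z) * v t)) {0..1}"
        by (intro integrable_integral integrable_continuous_interval cont)
      then show "((\<lambda>w. 1 / (w - ?z)) has_contour_integral integral {0..1} (\<lambda>t. 1 / (g t - ?z) * v t)) g"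
        unfolding has_contour_integral_def
        by (rule has_integral_eq[rotated]) (simp add: vd)
    qed
    also have "\<dots> = 2 * pi * \<i> * winding_number g ?z"
      using winding_number_valid_path[OF valid nin] by simp
    finally have "Im (Z z) = c * (2 * pi * Re (winding_number g ?z))" by simp
    moreover have "0 \<le> c" by (simp add: c_def)
    ultimately show ?case using wn[OF nin] by simp
  qed
  then have "0 \<le> (\<integral>z. Im (Z z) \<partial>(lborel \<Otimes>\<^sub>M lborel))"
    by (rule integral_nonneg_AE)
  also have "\<dots> = - 2 * pi * Re (integral {0..1} (\<lambda>t. v t * Im (g t)))"
    using Z by (simp add: integral_Im)
  finally have "Re (integral {0..1} (\<lambda>t. v t * Im (g t))) \<le> 0"
    using mult_pos_pos[OF pi_gt_zero, of "Re (integral {0..1} (\<lambda>t. v t * Im (g t)))"] by linarith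
  moreover have "((\<lambda>t. v t * Im (g t)) has_integral integral {0..1} (\<lambda>t. v t * Im (g t))) {0..1}"
    by (intro integrable_integral integrable_continuous_interval continuous_intros g v)
  from has_integral_Re[OF this] have "Re (integral {0..1} (\<lambda>t. v t * Im (g t))) = integral {0..1} (\<lambda>t. Re (v t) * Im (g t))"
    by (simp add: integral_unique)
  ultimately show ?thesis by simp
qed

section \<open>Liftings and the argument principle\<close>

text \<open>By the argument principle the winding number around \<open>z\<close> is the sum of those
  of \<open>b\<close> around the zeros of \<open>F - z\<close>, weighted by their orders; a
  polynomial has no poles, so no weight is negative.\<close>

lemma winding_number_power_comp_nonneg:
  fixes n :: nat and p z :: complex and b :: "real \<Rightarrow> complex"
  defines "F \<equiv> \<lambda>w. p + (w - p) ^ n"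
  assumes "0 < n" and b: "valid_path b" "pathfinish b = pathstart b"
    and wn: "\<And>w. w \<notin> path_image b \<Longrightarrow> 0 \<le> Re (winding_number b w) \<and> Im (winding_number b w) = 0"
    and z: "z \<notin> path_image (F \<circ> b)"
  shows "0 \<le> Re (winding_number (F \<circ> b) z)"
proof -
  define f where "f w = F w - z" for w
  have F: "F holomorphic_on UNIV" unfolding F_def by (intro holomorphic_intros)
  have f: "f holomorphic_on UNIV" unfolding f_def by (intro holomorphic_intros F)
  \<comment> \<open>The shape of the set is that of the argument principle with an empty set of
    poles.\<close>
  have fin: "finite {w \<in> UNIV. f w = 0 \<or> w \<in> {}}"
  proof -
    have "{w \<in> UNIV. f w = 0 \<or> w \<in> {}} \<subseteq> (\<lambda>u. u + p) ` {u. u ^ n = z - p}"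
    proof
      fix w assume "w \<in> {w \<in> UNIV. f w = 0 \<or> w \<in> {}}"
      then have "(w - p) ^ n = z - p" by (simp add: f_def F_def algebra_simps)
      then show "w \<in> (\<lambda>u. u + p) ` {u. u ^ n = z - p}"
        by (intro image_eqI[of _ _ "w - p"]) auto
    qed
    then show ?thesis using finite_nth_roots[OF \<open>0 < n\<close>, of "z - p"] finite_subset by blast
  qed
  have zeros: "f (b t) \<noteq> 0" if "t \<in> {0..1}" for t
    using z that by (auto simp: f_def path_image_def)
  have ord: "0 \<le> zorder f w" if "f w = 0" for w
  proof -
    have "\<exists>u\<in>UNIV. f u \<noteq> 0" using zeros[of 0] by auto
    from zorder_exist_zero[OF f open_UNIV connected_UNIV UNIV_I this, of w] that show ?thesis by auto
  qed
  have valid: "valid_path (F \<circ> b)"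
    by (rule valid_path_compose_holomorphic[OF b(1) F]) auto
  have "2 * pi * \<i> * winding_number (F \<circ> b) z = contour_integral (F \<circ> b) (\<lambda>w. 1 / (w - z))"
    using winding_number_valid_path[OF valid z] by simp
  also have "\<dots> = contour_integral b (\<lambda>w. deriv F w * (1 / (F w - z)))"
    by (rule contour_integral_comp_analyticW[OF _ b(1) subset_UNIV]) (simp add: analytic_on_open F)
  also have "\<dots> = contour_integral b (\<lambda>w. deriv f w * 1 / f w)"
  proof -
    have "deriv f w = deriv F w" for w
      unfolding f_def using F by (subst deriv_diff) (auto simp: holomorphic_on_imp_differentiable_at)
    then show ?thesis by (simp add: f_def)
  qed
  also have "\<dots> = 2 * pi * \<i> * (\<Sum>w\<in>{w \<in> UNIV. f w = 0 \<or> w \<in> {}}. winding_number b w * 1 * zorder f w)"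
    by (rule argument_principle) (use f b fin zeros in \<open>auto simp: path_image_def\<close>)
  finally have "winding_number (F \<circ> b) z = (\<Sum>w | f w = 0. winding_number b w * zorder f w)" by simp
  also have "Re \<dots> \<ge> 0"
    unfolding Re_sum
  proof (rule sum_nonneg)
    fix w assume w: "w \<in> {w. f w = 0}"
    then have "w \<notin> path_image b" using zeros by (auto simp: path_image_def)
    from wn[OF this] ord[of w] w show "0 \<le> Re (winding_number b w * zorder f w)" by simp
  qed
  finally show ?thesis .
qed

text \<open>A simple closed curve winds once around its inside, in one sense or the other. The
  counterclockwise sense would give \<open>b\<close>, hence \<open>\<alpha>\<close>, nonnegative
  winding numbers, against the sign in \<open>pos\<close>.\<close>

lemma lifting_traverses_clockwise:
  assumes lift: "n_simple_lifting n p T \<alpha> \<beta>"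
    and der: "\<And>t. t \<in> {0..T} \<Longrightarrow> (\<alpha> has_vector_derivative w t) (at t within {0..T})"
    and w: "continuous_on {0..T} w"
    and pos: "0 < integral {0..T} (\<lambda>t. Re (w t) * Im (\<alpha> t))"
  shows "traverses_clockwise T \<beta>"
proof -
  from lift obtain u where n: "0 < n" and T: "0 < T" and \<beta>_closed: "\<beta> T = \<beta> 0" and inj: "inj_on \<beta> {0..<T}"
    and u: "continuous_on {0..T} u"
    and \<beta>_der: "\<And>t. t \<in> {0..T} \<Longrightarrow> (\<beta> has_vector_derivative u t) (at t within {0..T})"
    and \<alpha>: "\<And>t. t \<in> {0..T} \<Longrightarrow> \<alpha> t = p + (\<beta> t - p) ^ n"
    unfolding n_simple_lifting_def simple_regular_closed_curve_def by blast
  define b where "b s = \<beta> (T * s)" for s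
  define g where "g s = \<alpha> (T * s)" for s
  have img: "(\<lambda>s. T * s) ` {0..1} = {0..T}"
    using T by (auto simp: image_mult_atLeastAtMost_if)
  have mem: "T * s \<in> {0..T}" if "s \<in> {0..1}" for s using img that by blast
  have rescale: "((\<lambda>s. h (T * s)) has_vector_derivative T *\<^sub>R h' (T * s)) (at s within {0..1})"
    if "\<And>t. t \<in> {0..T} \<Longrightarrow> (h has_vector_derivative h' t) (at t within {0..T})" "s \<in> {0..1}"
    for h h' :: "real \<Rightarrow> complex" and s
  proof -
    have "((\<lambda>s. T * s) has_vector_derivative T) (at s within {0..1})"
      by (auto intro!: derivative_eq_intros)
    from vector_diff_chain_within[OF this, of h "h' (T * s)"] show ?thesis
      using that(1)[OF mem[OF that(2)]] by (simp add: img o_def)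
  qed
  have cont: "continuous_on {0..1} (\<lambda>s. T *\<^sub>R h (T * s))" if "continuous_on {0..T} h" for h :: "real \<Rightarrow> complex"
    by (intro continuous_intros continuous_on_compose2[OF that]) (use mem in auto)
  have b_der: "(b has_vector_derivative T *\<^sub>R u (T * s)) (at s within {0..1})" if "s \<in> {0..1}" for s
    unfolding b_def by (rule rescale[OF \<beta>_der that])
  have g_der: "(g has_vector_derivative T *\<^sub>R w (T * s)) (at s within {0..1})" if "s \<in> {0..1}" for s
    unfolding g_def by (rule rescale[OF der that])
  have valid: "valid_path b" by (rule valid_path_C1[OF b_der cont[OF u]])
  have loop: "pathfinish b = pathstart b" using \<beta>_closed by (simp add: b_def pathfinish_def pathstart_def)
  \<comment> \<open>Injectivity on the half-open interval leaves the coincidence of the end points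
    as the only one.\<close>
  have simple: "simple_path b"
    unfolding simple_path_def loop_free_def
  proof (intro conjI ballI impI)
    fix x y :: real assume xy: "x \<in> {0..1}" "y \<in> {0..1}" "b x = b y"
    have eq: "x = y" if "x \<in> {0..<1}" "y \<in> {0..<1}" "b x = b y" for x y
      using inj_onD[OF inj, of "T * x" "T * y"] that T by (simp add: b_def)
    have b1: "b 1 = b 0" using \<beta>_closed by (simp add: b_def)
    consider "x \<in> {0..<1}" "y \<in> {0..<1}" | "x = 1" "y = 1" | "x = 1" "y \<in> {0..<1}" | "x \<in> {0..<1}" "y = 1"
      using xy(1,2) by force
    then show "x = y \<or> x = 0 \<and> y = 1 \<or> x = 1 \<and> y = 0"
    proof cases
      case 1
      then show ?thesis using eq[OF 1 xy(3)] by simp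
    next
      case 3
      then have "y = 0" using eq[of y 0] xy(3) b1 by simp
      then show ?thesis using 3 by simp
    next
      case 4
      then have "x = 0" using eq[of x 0] xy(3) b1 by simp
      then show ?thesis using 4 by simp
    qed simp
  qed (rule valid_path_imp_path[OF valid])
  have region: "enclosed_region T \<beta> = inside (path_image b)"
    unfolding enclosed_region_def path_image_def b_def img[symmetric] image_image ..
  from simple_closed_path_winding_number_inside[OF simple] show ?thesis
  proof cases
    case 2
    then show ?thesis unfolding traverses_clockwise_def region by (simp add: b_def[abs_def])
  next
    \<comment> \<open>The counterclockwise case, to be refuted: all points off the curve have
      winding number 1 or 0.\<close>
    case 1
    have wn: "0 \<le> Re (winding_number b z) \<and> Im (winding_number b z) = 0" if "z \<notin> path_image b" for z
    proof (cases "z \<in> inside (path_image b)")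
      case False
      then have "z \<in> outside (path_image b)" using that inside_Un_outside[of "path_image b"] by blast
      then show ?thesis
        using winding_number_zero_in_outside[OF valid_path_imp_path[OF valid] loop] by simp
    qed (simp add: 1)
    let ?F = "\<lambda>w. p + (w - p) ^ n"
    have gF: "g s = (?F \<circ> b) s" if "s \<in> {0..1}" for s
      using \<alpha>[OF mem[OF that]] by (simp add: g_def b_def)
    have "integral {0..1} (\<lambda>s. Re (T *\<^sub>R w (T * s)) * Im (g s)) \<le> 0"
    proof (rule integral_Re_Im_nonpos[OF g_der cont[OF w]])
      show "g 1 = g 0" using gF[of 0] gF[of 1] loop by (simp add: pathfinish_def pathstart_def)
      fix z assume "z \<notin> path_image g"
      also have "path_image g = path_image (?F \<circ> b)"
        unfolding path_image_def by (rule image_cong[OF refl gF])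
      finally have "0 \<le> Re (winding_number (?F \<circ> b) z)"
        by (intro winding_number_power_comp_nonneg[OF n valid loop wn])
      also have "winding_number (?F \<circ> b) z = winding_number g z"
        by (rule winding_number_cong) (use gF in auto)
      finally show "0 \<le> Re (winding_number g z)" .
    qed
    moreover have "integral {0..1} (\<lambda>s. Re (T *\<^sub>R w (T * s)) * Im (g s)) = integral {0..T} (\<lambda>t. Re (w t) * Im (\<alpha> t))"
    proof -
      let ?I = "integral {0..T} (\<lambda>t. Re (w t) * Im (\<alpha> t))"
      have \<alpha>_cont: "continuous_on {0..T} \<alpha>"
        using der has_vector_derivative_continuous continuous_on_eq_continuous_within by blast
      have "((\<lambda>t. Re (w t) * Im (\<alpha> t)) has_integral ?I) {0..T}"
        by (intro integrable_integral integrable_continuous_interval continuous_intros w \<alpha>_cont)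
      then have "((\<lambda>t. Re (w t) * Im (\<alpha> t)) has_integral ?I) (cbox 0 T)" by simp
      \<comment> \<open>The factor \<open>1 / T\<close> of the substitution cancels against the
        factor \<open>T\<close> of the rescaled velocity.\<close>
      from has_integral_affinity'[OF this T, of 0]
      have "integral {0..1} (\<lambda>s. Re (w (T * s)) * Im (\<alpha> (T * s))) = inverse T * ?I"
        using T by (simp add: integral_unique)
      then show ?thesis using T by (simp add: g_def mult.assoc)
    qed
    ultimately show ?thesis using pos by simp
  qed
qed

subsection \<open>Motion near a triangular point\<close>

text \<open>Shift \<open>d\<close> and offset \<open>e\<close> are free so that one formula serves
  both coordinates and both primaries.\<close>

lemma has_real_derivative_inverse_distance:
  fixes x d e c :: real
  assumes "0 < (x + d)\<^sup>2 + e"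
  shows "((\<lambda>u. c / sqrt ((u + d)\<^sup>2 + e)) has_real_derivative - (c * (x + d) / sqrt ((x + d)\<^sup>2 + e) ^ 3)) (at x)"
proof -
  let ?q = "sqrt ((x + d)\<^sup>2 + e)"
  have "((\<lambda>u. (u + d)\<^sup>2 + e) has_real_derivative 2 * (x + d)) (at x)"
    by (auto intro!: derivative_eq_intros)
  from DERIV_chain2[OF DERIV_real_sqrt[OF assms] this]
  have "((\<lambda>u. sqrt ((u + d)\<^sup>2 + e)) has_real_derivative inverse ?q / 2 * (2 * (x + d))) (at x)" .
  moreover have "?q \<noteq> 0" using assms by simp
  ultimately have "((\<lambda>u. c / sqrt ((u + d)\<^sup>2 + e)) has_real_derivative
      (0 * ?q - c * (inverse ?q / 2 * (2 * (x + d)))) / (?q * ?q)) (at x)"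
    by (intro DERIV_divide DERIV_const)
  moreover have "(0 * q - c * (inverse q / 2 * (2 * (x + d)))) / (q * q) = - (c * (x + d) / q ^ 3)" for q
    by (cases "q = 0") (simp_all add: field_simps power3_eq_cube)
  ultimately show ?thesis by (simp only:)
qed

lemma deriv_omega:
  assumes "0 < (y1 + \<mu>)\<^sup>2 + y2\<^sup>2" "0 < (y1 + \<mu> - 1)\<^sup>2 + y2\<^sup>2"
  defines "r1 \<equiv> sqrt ((y1 + \<mu>)\<^sup>2 + y2\<^sup>2)" and "r2 \<equiv> sqrt ((y1 + \<mu> - 1)\<^sup>2 + y2\<^sup>2)"
  shows "deriv (\<lambda>u. omega \<mu> u y2) y1 = y1 - (1 - \<mu>) * (y1 + \<mu>) / r1 ^ 3 - \<mu> * (y1 + \<mu> - 1) / r2 ^ 3"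
    and "deriv (\<lambda>u. omega \<mu> y1 u) y2 = y2 - (1 - \<mu>) * y2 / r1 ^ 3 - \<mu> * y2 / r2 ^ 3"
proof -
  have "((\<lambda>u. (u\<^sup>2 + y2\<^sup>2) / 2 + (1 - \<mu>) / sqrt ((u + \<mu>)\<^sup>2 + y2\<^sup>2) + \<mu> / sqrt ((u + (\<mu> - 1))\<^sup>2 + y2\<^sup>2))
    has_real_derivative y1 + - ((1 - \<mu>) * (y1 + \<mu>) / sqrt ((y1 + \<mu>)\<^sup>2 + y2\<^sup>2) ^ 3)
      + - (\<mu> * (y1 + (\<mu> - 1)) / sqrt ((y1 + (\<mu> - 1))\<^sup>2 + y2\<^sup>2) ^ 3)) (at y1)"
    by (intro DERIV_add has_real_derivative_inverse_distance)
       (use assms in \<open>auto intro!: derivative_eq_intros simp: algebra_simps\<close>)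
  then show "deriv (\<lambda>u. omega \<mu> u y2) y1 = y1 - (1 - \<mu>) * (y1 + \<mu>) / r1 ^ 3 - \<mu> * (y1 + \<mu> - 1) / r2 ^ 3"
    unfolding omega_def r1_def r2_def by (intro DERIV_imp_deriv) (simp add: add_diff_eq)
  have "((\<lambda>u. (u\<^sup>2 + y1\<^sup>2) / 2 + (1 - \<mu>) / sqrt ((u + 0)\<^sup>2 + (y1 + \<mu>)\<^sup>2) + \<mu> / sqrt ((u + 0)\<^sup>2 + (y1 + \<mu> - 1)\<^sup>2))
    has_real_derivative y2 + - ((1 - \<mu>) * (y2 + 0) / sqrt ((y2 + 0)\<^sup>2 + (y1 + \<mu>)\<^sup>2) ^ 3)
      + - (\<mu> * (y2 + 0) / sqrt ((y2 + 0)\<^sup>2 + (y1 + \<mu> - 1)\<^sup>2) ^ 3)) (at y2)"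
    by (intro DERIV_add has_real_derivative_inverse_distance)
       (use assms in \<open>auto intro!: derivative_eq_intros simp: algebra_simps\<close>)
  then show "deriv (\<lambda>u. omega \<mu> y1 u) y2 = y2 - (1 - \<mu>) * y2 / r1 ^ 3 - \<mu> * y2 / r2 ^ 3"
    unfolding omega_def r1_def r2_def by (intro DERIV_imp_deriv) (simp add: add.commute)
qed

text \<open>\<open>A\<close> stands for the inner product of the displacement with the unit vector
  from a primary to the triangular point, \<open>\<delta>\<close> for the squared displacement,
  \<open>r\<close> for the new distance. The right-hand side is the share of that primary in the
  radial derivative of the potential, up to its mass.\<close>

lemma attraction_term_ge:
  fixes r A \<delta> :: real
  assumes r: "r\<^sup>2 = 1 + 2 * A + \<delta>" "9/10 \<le> r" "r \<le> 11/10"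
  shows "2 * (A + 3/4 * \<delta>)\<^sup>2 - \<delta>\<^sup>2 / 4 \<le> (1 - 1 / r ^ 3) * (A + \<delta>)"
proof -
  \<comment> \<open>\<open>\<rho>\<close> is close to \<open>3/2\<close>, and \<open>(2 A + \<delta>) (A + \<delta>)\<close> is completed to a square.\<close>
  define \<rho> where "\<rho> = (r\<^sup>2 + r + 1) / (r ^ 3 * (r + 1))"
  have r0: "0 < r ^ 3 * (r + 1)" using r by simp
  have "r ^ 4 + r ^ 3 \<le> r\<^sup>2 + r + 1"
  proof (cases "r \<le> 1")
    case True
    then have "r ^ 4 \<le> r ^ 2" "r ^ 3 \<le> r ^ 1" using r by (intro power_decreasing; simp)+
    then show ?thesis by simp
  next
    case False
    have "r ^ 4 \<le> (11/10) ^ 4" "r ^ 3 \<le> (11/10) ^ 3" using r by (intro power_mono; simp)+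
    moreover have "1 \<le> r\<^sup>2" using False by (intro one_le_power) simp
    moreover have "(11/10) ^ 4 + (11/10) ^ 3 \<le> (3::real)" by (simp add: power_divide)
    ultimately show ?thesis using False by linarith
  qed
  then have "1 \<le> \<rho>" using r0 unfolding \<rho>_def by (subst le_divide_eq_1_pos) (auto simp: algebra_simps power_numeral_reduce)
  have "\<rho> \<le> 2"
  proof -
    \<comment> \<open>Expanding around the lower end \<open>9/10\<close> of the range of
      \<open>r\<close> makes all coefficients positive.\<close>
    define e where "e = r - 9/10"
    have "0 \<le> e" using r by (simp add: e_def)
    have "2 * (r ^ 3 * (r + 1)) - (r\<^sup>2 + r + 1)
      = 2 * e ^ 4 + (92/10) * e ^ 3 + (1412/100) * e ^ 2 + (7892/1000) * e + 602/10000"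
      unfolding e_def by (simp add: field_simps power_numeral_reduce)
    also have "\<dots> \<ge> 0" using \<open>0 \<le> e\<close> by simp
    finally show ?thesis using r0 unfolding \<rho>_def by (subst pos_divide_le_eq) auto
  qed
  have "2 * A + \<delta> = (r - 1) * (r + 1)" using r(1) by (simp add: algebra_simps power2_eq_square)
  moreover have "1 - 1 / r ^ 3 = \<rho> * ((r - 1) * (r + 1))"
    using r(2) unfolding \<rho>_def
    by (simp add: divide_simps) (simp add: algebra_simps power_numeral_reduce)
  ultimately have "1 - 1 / r ^ 3 = \<rho> * (2 * A + \<delta>)" by simp
  then have "(1 - 1 / r ^ 3) * (A + \<delta>) = \<rho> * (2 * (A + 3/4 * \<delta>)\<^sup>2) - \<rho> * (\<delta>\<^sup>2 / 8)"
    by (simp only:) (simp add: algebra_simps power2_eq_square)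
  \<comment> \<open>The square needs \<open>\<rho>\<close> bounded from below, the subtracted
    remainder from above.\<close>
  moreover have "1 * (2 * (A + 3/4 * \<delta>)\<^sup>2) \<le> \<rho> * (2 * (A + 3/4 * \<delta>)\<^sup>2)"
    by (rule mult_right_mono) (use \<open>1 \<le> \<rho>\<close> in auto)
  moreover have "\<rho> * (\<delta>\<^sup>2 / 8) \<le> 2 * (\<delta>\<^sup>2 / 8)"
    by (rule mult_right_mono) (use \<open>\<rho> \<le> 2\<close> in auto)
  ultimately show ?thesis by simp
qed

text \<open>\<open>(a, s)\<close> is the unit vector from a primary to the triangular point. Its
  inner product with a displacement of length at most \<open>1/20\<close> is at most
  \<open>1/20\<close> in size, which leaves room in the bounds for \<open>r\<close>.\<close>

lemma distance_near_triangular_point: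
  fixes a s h1 h2 :: real
  assumes "a\<^sup>2 + s\<^sup>2 = 1" "h1\<^sup>2 + h2\<^sup>2 \<le> 1/400"
  defines "r \<equiv> sqrt ((a + h1)\<^sup>2 + (s + h2)\<^sup>2)"
  shows "r\<^sup>2 = 1 + 2 * (a * h1 + s * h2) + (h1\<^sup>2 + h2\<^sup>2)" "9/10 \<le> r" "r \<le> 11/10"
proof -
  define A where "A = a * h1 + s * h2"
  have r2: "(a + h1)\<^sup>2 + (s + h2)\<^sup>2 = (a\<^sup>2 + s\<^sup>2) + 2 * A + (h1\<^sup>2 + h2\<^sup>2)"
    unfolding A_def by (simp add: algebra_simps power2_eq_square)
  moreover have "r\<^sup>2 = (a + h1)\<^sup>2 + (s + h2)\<^sup>2" unfolding r_def by simp
  ultimately show "r\<^sup>2 = 1 + 2 * (a * h1 + s * h2) + (h1\<^sup>2 + h2\<^sup>2)"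
    by (simp only: assms(1) A_def)
  \<comment> \<open>Lagrange's identity, from which the Cauchy-Schwarz bound on \<open>A\<close>
    follows.\<close>
  have "A\<^sup>2 + (a * h2 - s * h1)\<^sup>2 = (a\<^sup>2 + s\<^sup>2) * (h1\<^sup>2 + h2\<^sup>2)"
    unfolding A_def by (simp add: algebra_simps power2_eq_square)
  moreover have "0 \<le> (a * h2 - s * h1)\<^sup>2" by simp
  ultimately have "A\<^sup>2 \<le> 1/400" using assms(2) unfolding assms(1) mult_1_left by linarith
  then have "A\<^sup>2 \<le> (1/20)\<^sup>2" by (simp add: power_divide)
  then have "\<bar>A\<bar> \<le> 1/20" using abs_le_square_iff[of A "1/20"] by simp
  then have "-1/20 \<le> A" "A \<le> 1/20" by linarith+
  moreover have "0 \<le> h1\<^sup>2 + h2\<^sup>2" by simp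
  ultimately have "81/100 \<le> (a + h1)\<^sup>2 + (s + h2)\<^sup>2" "(a + h1)\<^sup>2 + (s + h2)\<^sup>2 \<le> 121/100"
    unfolding r2 assms(1) using assms(2) by linarith+
  then have "(9/10)\<^sup>2 \<le> (a + h1)\<^sup>2 + (s + h2)\<^sup>2" "(a + h1)\<^sup>2 + (s + h2)\<^sup>2 \<le> (11/10)\<^sup>2"
    unfolding power_divide by simp_all
  then show "9/10 \<le> r" "r \<le> 11/10"
    unfolding r_def by (auto intro: real_le_rsqrt dest: real_sqrt_le_mono)
qed

text \<open>The lower bounds for the two primaries add up to squares that are positive definite to
  leading order, because the directions to the triangular point are independent; the radius
  \<open>\<mu> / 10\<close> keeps the remaining terms, of order \<open>\<delta>^2\<close>, below
  them.\<close>

lemma radial_gradient_pos: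
  fixes \<mu> s h1 h2 :: real
  assumes \<mu>: "0 < \<mu>" "\<mu> \<le> 1/2" and s: "s\<^sup>2 = 3/4"
    and h: "h1\<^sup>2 + h2\<^sup>2 < (\<mu> / 10)\<^sup>2" "(h1, h2) \<noteq> (0, 0)"
  defines "y1 \<equiv> (1 - 2 * \<mu>) / 2 + h1" and "y2 \<equiv> s + h2"
  shows "0 < h1 * deriv (\<lambda>u. omega \<mu> u y2) y1 + h2 * deriv (\<lambda>u. omega \<mu> y1 u) y2"
proof -
  define \<delta> where "\<delta> = h1\<^sup>2 + h2\<^sup>2"
  have \<delta>0: "0 < \<delta>" using h(2) by (auto simp: \<delta>_def sum_power2_gt_zero_iff)
  have "\<mu>\<^sup>2 \<le> \<mu> * (1/2)" using \<mu> by (simp add: power2_eq_square)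
  then have \<delta>\<mu>: "\<delta> < \<mu> / 200" and \<delta>1: "\<delta> \<le> 1/400" using h(1) \<mu> by (simp_all add: \<delta>_def power_divide)
  define r1 where "r1 = sqrt ((y1 + \<mu>)\<^sup>2 + y2\<^sup>2)"
  define r2 where "r2 = sqrt ((y1 + \<mu> - 1)\<^sup>2 + y2\<^sup>2)"
  have y: "y1 + \<mu> = 1/2 + h1" "y1 + \<mu> - 1 = -1/2 + h1" "y2 = s + h2"
    by (simp_all add: y1_def y2_def field_simps)
  define A1 where "A1 = 1/2 * h1 + s * h2"
  define A2 where "A2 = -1/2 * h1 + s * h2"
  have unit: "(1/2)\<^sup>2 + s\<^sup>2 = 1" "(-1/2)\<^sup>2 + s\<^sup>2 = 1" using s by (simp_all add: power_divide)
  have d1: "r1\<^sup>2 = 1 + 2 * A1 + \<delta>" "9/10 \<le> r1" "r1 \<le> 11/10"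
    unfolding r1_def y(1,3) A1_def \<delta>_def
    by (rule distance_near_triangular_point[OF unit(1) \<delta>1[unfolded \<delta>_def]])+
  have d2: "r2\<^sup>2 = 1 + 2 * A2 + \<delta>" "9/10 \<le> r2" "r2 \<le> 11/10"
    unfolding r2_def y(2,3) A2_def \<delta>_def
    by (rule distance_near_triangular_point[OF unit(2) \<delta>1[unfolded \<delta>_def]])+
  have pos: "0 < (y1 + \<mu>)\<^sup>2 + y2\<^sup>2" "0 < (y1 + \<mu> - 1)\<^sup>2 + y2\<^sup>2"
    using less_le_trans[OF _ d1(2), of 0] less_le_trans[OF _ d2(2), of 0] by (simp_all add: r1_def r2_def)
  let ?G = "h1 * deriv (\<lambda>u. omega \<mu> u y2) y1 + h2 * deriv (\<lambda>u. omega \<mu> y1 u) y2"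
  have "?G = h1 * (y1 - (1 - \<mu>) * (y1 + \<mu>) / r1 ^ 3 - \<mu> * (y1 + \<mu> - 1) / r2 ^ 3)
      + h2 * (y2 - (1 - \<mu>) * y2 / r1 ^ 3 - \<mu> * y2 / r2 ^ 3)"
    unfolding deriv_omega[OF pos] r1_def r2_def ..
  \<comment> \<open>The origin is the centre of mass, so the centrifugal term splits between the
    primaries with weights \<open>1 - \<mu>\<close> and \<open>\<mu>\<close>.\<close>
  also have "\<dots> = (1 - \<mu>) * ((1 - 1 / r1 ^ 3) * (A1 + \<delta>)) + \<mu> * ((1 - 1 / r2 ^ 3) * (A2 + \<delta>))"
  proof -
    define p q where "p = 1 / r1 ^ 3" and "q = 1 / r2 ^ 3"
    have pq: "x / r1 ^ 3 = x * p" "x / r2 ^ 3 = x * q" for x by (simp_all add: p_def q_def)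
    show ?thesis unfolding pq A1_def A2_def \<delta>_def y1_def y2_def
      by (simp add: field_simps power2_eq_square)
  qed
  finally have G: "?G = \<dots>" .
  have combine: "L \<le> x + y" if "a \<le> x" "b \<le> y" "c \<le> d" "L = 2 * (c - d) + a + b" for a b c d x y L :: real
    using that by simp
  define B1 where "B1 = A1 + 3/4 * \<delta>"
  define B2 where "B2 = A2 + 3/4 * \<delta>"
  have "(1 - \<mu>) * (2 * B1\<^sup>2 - \<delta>\<^sup>2 / 4) \<le> (1 - \<mu>) * ((1 - 1 / r1 ^ 3) * (A1 + \<delta>))"
    unfolding B1_def by (rule mult_left_mono[OF attraction_term_ge[OF d1]]) (use \<mu> in simp)
  moreover have "\<mu> * (2 * B2\<^sup>2 - \<delta>\<^sup>2 / 4) \<le> \<mu> * ((1 - 1 / r2 ^ 3) * (A2 + \<delta>))"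
    unfolding B2_def by (rule mult_left_mono[OF attraction_term_ge[OF d2]]) (use \<mu> in simp)
  \<comment> \<open>As \<open>\<mu> \<le> 1/2\<close>, both squares can be given the smaller weight
    \<open>\<mu>\<close>.\<close>
  moreover have "\<mu> * B1\<^sup>2 \<le> (1 - \<mu>) * B1\<^sup>2"
    by (rule mult_right_mono) (use \<mu> in auto)
  moreover have "2 * \<mu> * (B1\<^sup>2 + B2\<^sup>2) - \<delta>\<^sup>2 / 4 = 2 * (\<mu> * B1\<^sup>2 - (1 - \<mu>) * B1\<^sup>2)
      + (1 - \<mu>) * (2 * B1\<^sup>2 - \<delta>\<^sup>2 / 4) + \<mu> * (2 * B2\<^sup>2 - \<delta>\<^sup>2 / 4)"
    by (simp add: field_simps)
  ultimately have "2 * \<mu> * (B1\<^sup>2 + B2\<^sup>2) - \<delta>\<^sup>2 / 4 \<le> ?G"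
    unfolding G by (rule combine)
  moreover have "2 * \<mu> * (B1\<^sup>2 + B2\<^sup>2) \<ge> \<mu> * (\<delta> - 9/4 * \<delta>\<^sup>2)"
  proof -
    have "0 \<le> (s * h2 + 3/2 * \<delta>)\<^sup>2" by simp
    moreover have "B1\<^sup>2 + B2\<^sup>2 = h1\<^sup>2 / 2 + 2 * (s * h2 + 3/4 * \<delta>)\<^sup>2"
      unfolding B1_def B2_def A1_def A2_def by (simp add: field_simps power2_eq_square)
    \<comment> \<open>Splitting off this square absorbs the mixed term in \<open>h2\<close> and
      \<open>\<delta>\<close>, whose sign is unknown.\<close>
    moreover have "2 * (s * h2 + 3/4 * \<delta>)\<^sup>2 = s\<^sup>2 * h2\<^sup>2 - 9/8 * \<delta>\<^sup>2 + (s * h2 + 3/2 * \<delta>)\<^sup>2"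
      by (simp add: field_simps power2_eq_square)
    ultimately have "2 * (B1\<^sup>2 + B2\<^sup>2) \<ge> h1\<^sup>2 + 3/2 * h2\<^sup>2 - 9/4 * \<delta>\<^sup>2" using s by simp
    moreover have "\<delta> \<le> h1\<^sup>2 + 3/2 * h2\<^sup>2" by (simp add: \<delta>_def)
    ultimately have "2 * (B1\<^sup>2 + B2\<^sup>2) \<ge> \<delta> - 9/4 * \<delta>\<^sup>2" by linarith
    from mult_left_mono[OF this, of \<mu>] \<mu> show ?thesis by simp
  qed
  moreover have "\<delta>\<^sup>2 / 4 < \<mu> * (\<delta> - 9/4 * \<delta>\<^sup>2)"
  proof -
    have "\<mu> * \<delta> \<le> \<mu> * (1/400)" using \<mu> \<delta>1 by (intro mult_left_mono) auto
    then have "\<delta> / 4 + 9/4 * (\<mu> * \<delta>) < \<mu>" using \<delta>\<mu> \<mu> by linarith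
    then have "\<delta> / 4 < \<mu> * (1 - 9/4 * \<delta>)" by (simp add: algebra_simps)
    from mult_strict_right_mono[OF this \<delta>0] show ?thesis by (simp add: algebra_simps power2_eq_square)
  qed
  ultimately show ?thesis by linarith
qed

section \<open>Periodic orbits near a triangular point\<close>

lemma omega_triangular_point:
  assumes "s\<^sup>2 = 3/4"
  shows "2 * omega \<mu> ((1 - 2 * \<mu>) / 2) s = 3 - \<mu> + \<mu>\<^sup>2"
proof -
  have "((1 - 2 * \<mu>) / 2 + \<mu>)\<^sup>2 + s\<^sup>2 = 1" "((1 - 2 * \<mu>) / 2 + \<mu> - 1)\<^sup>2 + s\<^sup>2 = 1"
    using assms by (simp_all add: field_simps power2_eq_square)
  then show ?thesis using assms unfolding omega_def by (simp add: field_simps power2_eq_square)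
qed

lemma periodic_solution_deriv_eq:
  assumes "periodic_solution \<mu> T y1 y2"
  shows "deriv y1 T = deriv y1 0" "deriv y2 T = deriv y2 0"
proof -
  have "deriv y T = deriv y 0" if "\<And>t. y differentiable (at t)" "\<And>t. y (t + T) = y t" for y :: "real \<Rightarrow> real"
  proof -
    have "(y has_real_derivative deriv y (0 + T)) (at (0 + T))"
      using that(1) by (simp add: DERIV_deriv_iff_real_differentiable)
    then have "((\<lambda>t. y (t + T)) has_real_derivative deriv y (0 + T)) (at 0)"
      by (simp only: DERIV_shift)
    then show ?thesis using that(2) by (simp add: DERIV_imp_deriv)
  qed
  then show "deriv y1 T = deriv y1 0" "deriv y2 T = deriv y2 0"
    using assms unfolding periodic_solution_def solution_def by blast+
qed

lemma solution_derivatives: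
  assumes "solution \<mu> y1 y2"
  shows "(y1 has_real_derivative deriv y1 t) (at t)" "(y2 has_real_derivative deriv y2 t) (at t)"
    and "continuous_on S (deriv y1)" "continuous_on S (deriv y2)"
  using assms unfolding solution_def
  by (auto simp: DERIV_deriv_iff_real_differentiable intro!: DERIV_continuous_on[OF has_field_derivative_at_within])

text \<open>\<open>P\<close> returns to its initial value after a period, while
  \<open>P + 4 * ?I\<close> has the derivative \<open>E\<close>. Hence four times the integral is
  the increase of a function with positive derivative.\<close>

lemma periodic_integral_pos:
  assumes \<mu>: "0 < \<mu>" "\<mu> \<le> 1/2" and s: "s\<^sup>2 = 3/4"
    and per: "periodic_solution \<mu> T y1 y2"
    and jac: "has_jacobian_integral \<mu> y1 y2 C" "C \<noteq> 3 - \<mu> + \<mu>\<^sup>2"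
    and ball: "\<And>t. Complex (y1 t) (y2 t) \<in> ball (Complex ((1 - 2 * \<mu>) / 2) s) (\<mu> / 10)"
  shows "0 < integral {0..T} (\<lambda>t. deriv y1 t * y2 t)"
proof -
  have sol: "solution \<mu> y1 y2" and T: "0 < T" and yT: "y1 T = y1 0" "y2 T = y2 0"
    using per unfolding periodic_solution_def by (auto dest: spec[of _ 0])
  note vT = periodic_solution_deriv_eq[OF per]
  note D = solution_derivatives[OF sol]
  let ?v1 = "deriv y1" and ?v2 = "deriv y2"
  define h1 where "h1 t = y1 t - (1 - 2 * \<mu>) / 2" for t
  define h2 where "h2 t = y2 t - s" for t
  define G1 where "G1 t = deriv (\<lambda>u. omega \<mu> u (y2 t)) (y1 t)" for t
  define G2 where "G2 t = deriv (\<lambda>u. omega \<mu> (y1 t) u) (y2 t)" for t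
  have DD: "(?v1 has_real_derivative G1 t + 2 * ?v2 t) (at t)" "(?v2 has_real_derivative G2 t - 2 * ?v1 t) (at t)" for t
    using sol unfolding solution_def G1_def G2_def by auto
  define E where "E t = (?v1 t)\<^sup>2 + (?v2 t)\<^sup>2 + (h1 t * G1 t + h2 t * G2 t)" for t
  have E: "0 < E t" for t
  proof (cases "(h1 t, h2 t) = (0, 0)")
    \<comment> \<open>At the triangular point \<open>2 * omega\<close> equals
      \<open>3 - \<mu> + \<mu>^2\<close>, so a different \<open>C\<close> leaves a nonzero
      speed.\<close>
    case True
    then have "y1 t = (1 - 2 * \<mu>) / 2" "y2 t = s" by (simp_all add: h1_def h2_def)
    then have "C = - ((?v1 t)\<^sup>2 + (?v2 t)\<^sup>2) + (3 - \<mu> + \<mu>\<^sup>2)"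
      using jac(1) omega_triangular_point[OF s, of \<mu>] unfolding has_jacobian_integral_def
      by (metis (no_types, lifting) diff_conv_add_uminus minus_add_distrib)
    then have "?v1 t \<noteq> 0 \<or> ?v2 t \<noteq> 0" using jac(2) by auto
    then show ?thesis using True by (simp add: E_def sum_power2_gt_zero_iff)
  next
    case False
    have "sqrt ((h1 t)\<^sup>2 + (h2 t)\<^sup>2) < \<mu> / 10"
      using ball[of t] by (simp add: dist_norm h1_def h2_def cmod_def power2_commute[of "y1 t"] power2_commute[of "y2 t"])
    then have "(h1 t)\<^sup>2 + (h2 t)\<^sup>2 < (\<mu> / 10)\<^sup>2"
      using \<mu> by (metis real_sqrt_less_iff real_sqrt_unique less_imp_le divide_pos_pos zero_less_numeral)
    from radial_gradient_pos[OF \<mu> s this False]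
    have "0 < h1 t * G1 t + h2 t * G2 t" by (simp add: h1_def h2_def G1_def G2_def)
    then show ?thesis unfolding E_def by (simp add: add_nonneg_pos)
  qed
  have cont: "continuous_on {0..T} (\<lambda>t. ?v1 t * y2 t)"
    using D(2) by (intro continuous_on_mult D DERIV_continuous_on) (auto intro: has_field_derivative_at_within)
  let ?I = "\<lambda>t. integral {0..t} (\<lambda>t. ?v1 t * y2 t)"
  \<comment> \<open>The term \<open>2 h\<^sub>1 h\<^sub>2\<close> turns the Coriolis contribution \<open>2 (h\<^sub>1 v\<^sub>2 - h\<^sub>2 v\<^sub>1)\<close> into \<open>- 4 h\<^sub>2 v\<^sub>1\<close>, and
    \<open>4 s h\<^sub>1\<close> replaces \<open>h\<^sub>2\<close> by \<open>y\<^sub>2\<close>.\<close>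
  define P where "P t = h1 t * ?v1 t + h2 t * ?v2 t - 2 * h1 t * h2 t - 4 * s * h1 t" for t
  have P: "(P has_real_derivative E t - 4 * (?v1 t * y2 t)) (at t)" for t
    unfolding P_def[abs_def] h1_def h2_def
    by (rule derivative_eq_intros D DD refl)+
       (simp add: E_def h1_def h2_def field_simps power2_eq_square)
  have "P 0 + 4 * ?I 0 < P T + 4 * ?I T"
  proof (rule DERIV_pos_imp_increasing_open[OF T])
    fix t assume t: "0 < t" "t < T"
    have "(?I has_vector_derivative ?v1 t * y2 t) (at t within {0..T})"
      by (rule integral_has_vector_derivative[OF cont]) (use t in auto)
    moreover have "at t within {0..T} = at t" using t by (intro at_within_interior) auto
    ultimately have "(?I has_real_derivative ?v1 t * y2 t) (at t)"
      by (simp add: has_real_derivative_iff_has_vector_derivative)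
    from DERIV_add[OF P DERIV_cmult[OF this, of 4]]
    show "\<exists>y. ((\<lambda>t. P t + 4 * ?I t) has_real_derivative y) (at t) \<and> 0 < y"
      using E[of t] by auto
  next
    show "continuous_on {0..T} (\<lambda>t. P t + 4 * ?I t)"
      using P by (intro continuous_intros DERIV_continuous_on[of _ P] indefinite_integral_continuous_1
          integrable_continuous_interval cont) (auto intro: has_field_derivative_at_within)
  qed
  moreover have "P T = P 0" using yT vT by (simp add: P_def h1_def h2_def)
  ultimately show ?thesis by simp
qed

lemma orbits_clockwise_near_triangular_point:
  assumes "0 < \<mu>" "\<mu> \<le> 1/2" and "s\<^sup>2 = 3/4"
    and per: "periodic_solution \<mu> T y1 y2"
    and "has_jacobian_integral \<mu> y1 y2 C" "C \<noteq> 3 - \<mu> + \<mu>\<^sup>2"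
    and "\<And>t. Complex (y1 t) (y2 t) \<in> ball (Complex ((1 - 2 * \<mu>) / 2) s) (\<mu> / 10)"
    and orient: "has_orientation T (\<lambda>t. Complex (y1 t) (y2 t))"
  shows "orbits_clockwise T (\<lambda>t. Complex (y1 t) (y2 t))"
proof -
  let ?\<alpha> = "\<lambda>t. Complex (y1 t) (y2 t)"
  let ?w = "\<lambda>t. Complex (deriv y1 t) (deriv y2 t)"
  have pos: "0 < integral {0..T} (\<lambda>t. Re (?w t) * Im (?\<alpha> t))"
    using periodic_integral_pos[of \<mu> s T y1 y2 C] assms by simp
  have "solution \<mu> y1 y2" using per by (simp add: periodic_solution_def)
  note D = solution_derivatives[OF this]
  have der: "(?\<alpha> has_vector_derivative ?w t) (at t within {0..T})" for t
    unfolding Complex_eq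
    by (rule has_vector_derivative_at_within, intro derivative_intros has_vector_derivative_of_real)
       (use D(1,2) in \<open>simp_all add: has_real_derivative_iff_has_vector_derivative\<close>)
  have cont: "continuous_on {0..T} ?w"
    unfolding Complex_eq by (intro continuous_intros D)
  have lift: "traverses_clockwise T \<beta>" if "n_simple_lifting n p T ?\<alpha> \<beta>" for n p \<beta>
    by (rule lifting_traverses_clockwise[OF that der cont pos])
  \<comment> \<open>A simple curve is its own lifting with \<open>n = 1\<close> around any point of
    its inside. Splitting off an empty inside, where the claim is vacuous, avoids proving that such
    a point exists.\<close>
  moreover have "traverses_clockwise T ?\<alpha>" if simple: "simple_regular_closed_curve T ?\<alpha>"
  proof (cases "enclosed_region T ?\<alpha> = {}")
    case False
    then obtain p where "p \<in> enclosed_region T ?\<alpha>" by blast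
    then have "n_simple_lifting 1 p T ?\<alpha> ?\<alpha>" using simple by (simp add: n_simple_lifting_def)
    then show ?thesis by (rule lift)
  qed (simp add: traverses_clockwise_def)
  ultimately show ?thesis using orient unfolding orbits_clockwise_def by blast
qed

theorem theorem5p1:
  fixes \<mu> :: real
  assumes "0 < \<mu>" and "\<mu> \<le> 1 / 2"
  shows "\<forall>L \<in> {L4 \<mu>, L5 \<mu>}. \<exists>\<epsilon>>0. \<forall>T y1 y2 C.
           periodic_solution \<mu> T y1 y2 \<and>
           has_jacobian_integral \<mu> y1 y2 C \<and> C \<noteq> 3 - \<mu> + \<mu>\<^sup>2 \<and>
           (\<forall>t. Complex (y1 t) (y2 t) \<in> ball L \<epsilon>) \<and>
           has_orientation T (\<lambda>t. Complex (y1 t) (y2 t)) \<longrightarrow>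
           orbits_clockwise T (\<lambda>t. Complex (y1 t) (y2 t))"
proof
  fix L assume "L \<in> {L4 \<mu>, L5 \<mu>}"
  then have "L = Complex ((1 - 2 * \<mu>) / 2) (sqrt 3 / 2) \<or> L = Complex ((1 - 2 * \<mu>) / 2) (- sqrt 3 / 2)"
    by (simp add: L4_def L5_def)
  moreover have "(sqrt 3 / 2)\<^sup>2 = 3/4" "(- sqrt 3 / 2)\<^sup>2 = 3/4" by (simp_all add: power_divide)
  \<comment> \<open>From here on only \<open>s^2 = 3/4\<close> is used, which treats both points at
    once.\<close>
  ultimately obtain s :: real where s: "s\<^sup>2 = 3/4" and L: "L = Complex ((1 - 2 * \<mu>) / 2) s"
    by blast
  show "\<exists>\<epsilon>>0. \<forall>T y1 y2 C.
           periodic_solution \<mu> T y1 y2 \<and>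
           has_jacobian_integral \<mu> y1 y2 C \<and> C \<noteq> 3 - \<mu> + \<mu>\<^sup>2 \<and>
           (\<forall>t. Complex (y1 t) (y2 t) \<in> ball L \<epsilon>) \<and>
           has_orientation T (\<lambda>t. Complex (y1 t) (y2 t)) \<longrightarrow>
           orbits_clockwise T (\<lambda>t. Complex (y1 t) (y2 t))"
  \<comment> \<open>The radius is the one for which \<open>radial_gradient_pos\<close> gives the
    sign.\<close>
  proof (intro exI[of _ "\<mu> / 10"] conjI allI impI)
    show "0 < \<mu> / 10" using assms by simp
  qed (use orbits_clockwise_near_triangular_point[OF assms s] L in blast)
qed

end
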